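(* Let $X=(X,\succcurlyeq_X)$ be a partially ordered, nonbranching and uniquely geodesic space, and $Y=(Y,\succcurlyeq_Y)$ a partially ordered metric space. Suppose $X$ is not isometric to an interval, and there exists an order-preserving geodesic ray $\sigma:[0,\infty)\to Y$ whose Busemann function is $\succcurlyeq_Y$-decreasing. If $(X,Y)$ has the monotone Lipschitz extension property, then $\succcurlyeq_X$ is trivial.
   Context: A partially ordered metric space is a (nonempty) metric space together with a partial order (reflexive, transitive, antisymmetric relation) on it; no compatibility between metric and order is assumed. The trivial order on $X$ is the equality relation. A metric space is uniquely geodesic if any two points are joined by exactly one geodesic (geodesics parametrized on $[0,1]$ are taken with constant speed: $d(\sigma(s),\sigma(t))=|s-t|\,d(\sigma(0),\sigma(1))$). A geodesic space $X$ is nonbranching if for any geodesics $\sigma,\sigma':[0,1]\to X$ with $\sigma|_{[0,\varepsilon)}=\sigma'|_{[0,\varepsilon)}$ for some $\varepsilon>0$, we have $\sigma=\sigma'$. "Interval" means an interval of $\mathbb{R}$ (possibly unbounded or degenerate to a point). A geodesic ray in $Y$ is a map $\sigma:[0,\infty)\to Y$ with $d_Y(\sigma(s),\sigma(t))=|s-t|$ for all $s,t\geq 0$; it is order-preserving if $\sigma(s)\succcurlyeq_Y\sigma(t)$ whenever $s\geq t\geq 0$. Its Busemann function is $B_\sigma:Y\to\mathbb{R}$, $B_\sigma(a):=\lim_{t\to\infty}(d_Y(a,\sigma(t))-t)$ (the limit always exists). $B_\sigma$ is $\succcurlyeq_Y$-decreasing if $a\succcurlyeq_Y b$ implies $B_\sigma(a)\leq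 B_\sigma(b)$. A map $f$ between partially ordered sets is order-preserving if $x\succcurlyeq_X y$ implies $f(x)\succcurlyeq_Y f(y)$; a map between metric spaces is 1-Lipschitz if $d_Y(f(x),f(y))\leq d_X(x,y)$ for all $x,y$. The pair $(X,Y)$ has the monotone Lipschitz extension property if for every nonempty $S\subseteq X$ (with the induced metric and order) and every order-preserving 1-Lipschitz map $f:S\to Y$, there is an order-preserving 1-Lipschitz map $F:X\to Y$ with $F|_S=f$. *)

theory Defs
  imports "HOL-Analysis.Analysis"
begin

text \<open>
  A partially ordered metric space is a type of sort \<open>{metric_space, order}\<close>: the two classes
  share no axiom, so metric and order are unrelated.  ``Order-preserving'' is \<^const>\<open>mono_on\<close>,
  ``decreasing'' is \<^const>\<open>antimono\<close>, and ``1-Lipschitz on S'' is \<open>1-lipschitz_on S\<close>.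

  Paths are total functions on the reals of which only the values on \<open>{0..1}\<close> (geodesics)
  or \<open>{0..}\<close> (rays) matter; equality of geodesics is therefore equality on \<open>{0..1}\<close>.
\<close>

definition geodesic :: "(real \<Rightarrow> 'a::metric_space) \<Rightarrow> bool" where
  "geodesic \<sigma> \<longleftrightarrow>
     (\<forall>s\<in>{0..1}. \<forall>t\<in>{0..1}. dist (\<sigma> s) (\<sigma> t) = \<bar>s - t\<bar> * dist (\<sigma> 0) (\<sigma> 1))"

definition uniquely_geodesic :: "'a::metric_space itself \<Rightarrow> bool" where
  "uniquely_geodesic TYPE('a) \<longleftrightarrow>
     (\<forall>x y :: 'a.
        (\<exists>\<sigma>. geodesic \<sigma> \<and> \<sigma> 0 = x \<and> \<sigma> 1 = y) \<and>
        (\<forall>\<sigma> \<tau>. geodesic \<sigma> \<and> \<sigma> 0 = x \<and> \<sigma> 1 = y \<and> geodesic \<tau> \<and> \<tau> 0 = x \<and> \<tau> 1 = y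
           \<longrightarrow> (\<forall>t\<in>{0..1}. \<sigma> t = \<tau> t)))"

definition nonbranching :: "'a::metric_space itself \<Rightarrow> bool" where
  "nonbranching TYPE('a) \<longleftrightarrow>
     (\<forall>\<sigma> \<tau> :: real \<Rightarrow> 'a. geodesic \<sigma> \<and> geodesic \<tau> \<and>
        (\<exists>\<epsilon>>0. \<forall>t\<in>{0..<\<epsilon>} \<inter> {0..1}. \<sigma> t = \<tau> t)
        \<longrightarrow> (\<forall>t\<in>{0..1}. \<sigma> t = \<tau> t))"

definition isometric :: "'a::metric_space set \<Rightarrow> 'b::metric_space set \<Rightarrow> bool" where
  "isometric A B \<longleftrightarrow>
     (\<exists>f. bij_betw f A B \<and> (\<forall>x\<in>A. \<forall>y\<in>A. dist (f x) (f y) = dist x y))"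

definition geodesic_ray :: "(real \<Rightarrow> 'a::metric_space) \<Rightarrow> bool" where
  "geodesic_ray \<sigma> \<longleftrightarrow> (\<forall>s\<ge>0. \<forall>t\<ge>0. dist (\<sigma> s) (\<sigma> t) = \<bar>s - t\<bar>)"

text \<open>For a geodesic ray, \<open>dist a (\<sigma> t) - t\<close> is nonincreasing in \<open>t \<ge> 0\<close> and bounded below by
  \<open>- dist a (\<sigma> 0)\<close>, so the limit exists.\<close>

definition busemann :: "(real \<Rightarrow> 'a::metric_space) \<Rightarrow> 'a \<Rightarrow> real" where
  "busemann \<sigma> a = Lim at_top (\<lambda>t. dist a (\<sigma> t) - t)"

definition monotone_lipschitz_extension_property ::
    "'a::{metric_space,order} itself \<Rightarrow> 'b::{metric_space,order} itself \<Rightarrow> bool" where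
  "monotone_lipschitz_extension_property TYPE('a) TYPE('b) \<longleftrightarrow>
     (\<forall>(S :: 'a set) (f :: 'a \<Rightarrow> 'b).
        S \<noteq> {} \<and> mono_on S f \<and> 1-lipschitz_on S f \<longrightarrow>
        (\<exists>F :: 'a \<Rightarrow> 'b. mono F \<and> 1-lipschitz_on UNIV F \<and> (\<forall>x\<in>S. F x = f x)))"

end

theory Submission
  imports Defs
begin

text \<open>
  The argument is by contraposition: if some \<open>b < a\<close> in \<open>X\<close>, then \<open>X\<close> is isometric to an
  interval.  The negated Busemann function of the ray is monotone, 1-Lipschitz, and inverse to
  \<open>\<sigma>\<close> along the ray, so it turns extensions into \<open>Y\<close> of maps with values on the ray into
  real-valued ones.  Extending from two-point sets \<open>{p, q}\<close> yields, unless \<open>q < p\<close>, a monotone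
  1-Lipschitz \<open>G : X \<rightarrow> \<real>\<close> growing by the full distance from \<open>p\<close> to \<open>q\<close>
  (\<open>extension_property_steep_function\<close>).

  Such functions force further inequalities.  If \<open>b < a\<close> and \<open>p\<close> is closer to
  \<open>a\<close> than to \<open>b\<close>, then \<open>b < p\<close>: otherwise \<open>G\<close> would climb from \<open>p\<close> to \<open>b\<close> by \<open>dist p b\<close>, hence
  from \<open>p\<close> to \<open>a\<close> by at least as much, which exceeds \<open>dist p a\<close>.  Therefore the points above \<open>b\<close>
  form an open and closed subset of \<open>X - {b}\<close>, and so, dually, do the points below \<open>b\<close>.  A geodesic
  that misses \<open>b\<close> thus stays on one side of \<open>b\<close> (\<open>same_side_unless_between\<close>): the order sees \<open>b\<close>
  separate two points only if \<open>b\<close> lies metrically between them.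

  A single strict inequality then propagates to all pairs, so the order is total
  (\<open>total_order_of_same_side\<close>), and order betweenness implies metric betweenness.  The signed
  distance from a base point is then an isometric embedding into \<open>\<real>\<close>, and its image is an interval
  because \<open>X\<close> is connected.
\<close>

section \<open>Busemann functions\<close>

text \<open>The function \<open>t \<mapsto> dist a (\<sigma> t) - t\<close> is nonincreasing and bounded below by the triangle
  inequality, so it converges to its infimum.\<close>

lemma busemann_tendsto:
  assumes "geodesic_ray \<sigma>"
  shows "((\<lambda>t. dist a (\<sigma> t) - t) \<longlongrightarrow> busemann \<sigma> a) at_top"
proof -
  let ?f = "\<lambda>t. dist a (\<sigma> t) - t"
  have ray: "dist (\<sigma> s) (\<sigma> t) = \<bar>s - t\<bar>" if "0 \<le> s" "0 \<le> t" for s t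
    using assms that by (auto simp: geodesic_ray_def)
  have decr: "?f t \<le> ?f s" if "0 \<le> s" "s \<le> t" for s t
    using dist_triangle[of a "\<sigma> t" "\<sigma> s"] ray[of s t] that by simp
  have bound: "- dist a (\<sigma> 0) \<le> ?f t" if "0 \<le> t" for t
    using dist_triangle[of "\<sigma> 0" "\<sigma> t" a] ray[of 0 t] that by (simp add: dist_commute)
  have bdd: "bdd_below (?f ` {0..})"
    using bound by (auto intro!: bdd_belowI)
  have "(?f \<longlongrightarrow> (INF t\<in>{0..}. ?f t)) at_top"
  proof (rule decreasing_tendsto)
    show "\<forall>\<^sub>F t in at_top. (INF t\<in>{0..}. ?f t) \<le> ?f t"
      using eventually_ge_at_top[of 0] by eventually_elim (auto intro!: cINF_lower bdd)
  next
    fix y assume "(INF t\<in>{0..}. ?f t) < y"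
    then obtain s where "0 \<le> s" "?f s < y"
      using bdd by (auto simp: cINF_less_iff)
    from eventually_ge_at_top[of s] show "\<forall>\<^sub>F t in at_top. ?f t < y"
    proof eventually_elim
      case (elim t)
      then show ?case using decr[OF \<open>0 \<le> s\<close>, of t] \<open>?f s < y\<close> by linarith
    qed
  qed
  then show ?thesis
    unfolding busemann_def by (simp add: tendsto_Lim)
qed

lemma busemann_le_add_dist:
  assumes "geodesic_ray \<sigma>"
  shows "busemann \<sigma> a \<le> busemann \<sigma> b + dist a b"
proof (rule tendsto_le[OF _ _ busemann_tendsto[OF assms]])
  show "((\<lambda>t. (dist b (\<sigma> t) - t) + dist a b) \<longlongrightarrow> busemann \<sigma> b + dist a b) at_top"
    by (intro tendsto_intros busemann_tendsto assms)
  show "\<forall>\<^sub>F t in at_top. dist a (\<sigma> t) - t \<le> dist b (\<sigma> t) - t + dist a b"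
    using dist_triangle[of a _ b] by (auto simp: algebra_simps)
qed simp

lemma busemann_on_ray:
  assumes "geodesic_ray \<sigma>" and "0 \<le> s"
  shows "busemann \<sigma> (\<sigma> s) = - s"
proof -
  from eventually_ge_at_top[of s]
  have "\<forall>\<^sub>F t in at_top. - s = dist (\<sigma> s) (\<sigma> t) - t"
    by eventually_elim (use assms in \<open>simp add: geodesic_ray_def\<close>)
  then have "((\<lambda>t. dist (\<sigma> s) (\<sigma> t) - t) \<longlongrightarrow> - s) at_top"
    by (rule Lim_transform_eventually[OF tendsto_const])
  then show ?thesis
    using busemann_tendsto[OF assms(1)] tendsto_unique trivial_limit_at_top_linorder by blast
qed

section \<open>Steep monotone functions\<close>

text \<open>The hypothesis \<open>\<not> q < p\<close> is exactly what makes the map \<open>p \<mapsto> \<sigma> 0\<close>, \<open>q \<mapsto> \<sigma> (dist p q)\<close>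
  order-preserving on \<open>{p, q}\<close>; the negated Busemann function pulls an extension of it back to
  \<open>\<real>\<close>.\<close>

lemma extension_property_steep_function:
  fixes \<sigma> :: "real \<Rightarrow> 'b::{metric_space,order}" and p q :: "'a::{metric_space,order}"
  assumes ray: "geodesic_ray \<sigma>" and mono: "mono_on {0..} \<sigma>"
    and anti: "antimono (busemann \<sigma>)"
    and ext: "monotone_lipschitz_extension_property TYPE('a) TYPE('b)"
    and "\<not> q < p"
  obtains G :: "'a \<Rightarrow> real"
  where "mono G" and "\<And>x y. G x \<le> G y + dist x y" and "G q = G p + dist p q"
proof -
  define f where "f x = \<sigma> (dist p x)" for x
  have "mono_on {p, q} f"
    using \<open>\<not> q < p\<close> mono by (auto simp: f_def mono_on_def less_le)
  moreover have "1-lipschitz_on {p, q} f"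
    using ray by (auto simp: f_def lipschitz_on_def geodesic_ray_def dist_commute)
  ultimately obtain F where F: "mono F" "1-lipschitz_on UNIV F" "\<forall>x\<in>{p, q}. F x = f x"
    using ext unfolding monotone_lipschitz_extension_property_def by (metis insert_not_empty)
  show thesis
  proof (rule that[of "\<lambda>x. - busemann \<sigma> (F x)"])
    show "mono (\<lambda>x. - busemann \<sigma> (F x))"
      using F(1) anti by (simp add: monotone_def)
    show "- busemann \<sigma> (F x) \<le> - busemann \<sigma> (F y) + dist x y" for x y
      using busemann_le_add_dist[OF ray, of "F y" "F x"] lipschitz_onD[OF F(2), of y x]
      by (simp add: dist_commute)
    show "- busemann \<sigma> (F q) = - busemann \<sigma> (F p) + dist p q"
      using F(3) busemann_on_ray[OF ray] by (simp add: f_def)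
  qed
qed

section \<open>Geodesics stay on one side of a point\<close>

lemma geodesic_connected_between:
  assumes "uniquely_geodesic TYPE('a::metric_space)"
  obtains C where "connected C" and "x \<in> C" and "y \<in> C"
    and "\<And>z :: 'a. z \<in> C \<Longrightarrow> dist x z + dist z y = dist x y"
proof -
  obtain \<gamma> where \<gamma>: "geodesic \<gamma>" "\<gamma> 0 = x" "\<gamma> 1 = y"
    using assms unfolding uniquely_geodesic_def by blast
  then have eq: "dist (\<gamma> s) (\<gamma> t) = \<bar>s - t\<bar> * dist x y" if "s \<in> {0..1}" "t \<in> {0..1}" for s t
    using that by (auto simp: geodesic_def)
  have "(dist x y)-lipschitz_on {0..1} \<gamma>"
    by (rule lipschitz_onI) (simp_all add: eq dist_real_def mult.commute)
  then have "connected (\<gamma> ` {0..1})"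
    by (intro connected_continuous_image lipschitz_on_continuous_on) auto
  moreover have "x \<in> \<gamma> ` {0..1}" "y \<in> \<gamma> ` {0..1}"
    using \<gamma> by force+
  moreover have "dist x z + dist z y = dist x y" if "z \<in> \<gamma> ` {0..1}" for z
  proof -
    from that obtain t where t: "t \<in> {0..1}" "z = \<gamma> t" by blast
    then show ?thesis
      using eq[of 0 t] eq[of t 1] \<gamma> by (simp add: algebra_simps)
  qed
  ultimately show thesis by (rule that)
qed

text \<open>A property that passes from \<open>x\<close> to every point closer to \<open>x\<close> than to \<open>b\<close> defines a subset of
  the complement of \<open>b\<close> that is open, because being closer to \<open>x\<close> than to \<open>b\<close> is an open condition,
  and whose complement is open, because the property would pass from any point of
  \<open>ball p (dist p b)\<close> to the centre \<open>p\<close>.\<close>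

lemma connected_propagates:
  fixes P :: "'a::metric_space \<Rightarrow> bool"
  assumes step: "\<And>x p. P x \<Longrightarrow> dist p x < dist p b \<Longrightarrow> P p"
    and "connected C" and "b \<notin> C" and "x \<in> C" and "P x" and "y \<in> C"
  shows "P y"
proof (rule ccontr)
  assume "\<not> P y"
  let ?U = "\<Union>z\<in>{z. z \<noteq> b \<and> P z}. {p. dist p z < dist p b}"
  let ?V = "\<Union>p\<in>{p. p \<noteq> b \<and> \<not> P p}. ball p (dist p b)"
  have "open ?U"
    by (intro open_UN ballI open_Collect_less continuous_intros)
  moreover have "open ?V"
    by (intro open_UN) auto
  moreover have "?U \<inter> ?V \<inter> C = {}"
    using step by (auto simp: disjoint_iff)
  moreover have "C \<subseteq> ?U \<union> ?V"
    using \<open>b \<notin> C\<close> by force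
  moreover have "x \<in> ?U \<inter> C"
    using \<open>b \<notin> C\<close> \<open>x \<in> C\<close> \<open>P x\<close> by (auto intro!: exI[of _ x])
  moreover have "y \<in> ?V \<inter> C"
    using \<open>b \<notin> C\<close> \<open>y \<in> C\<close> \<open>\<not> P y\<close> by (auto intro!: exI[of _ y])
  ultimately show False
    using connectedD[OF \<open>connected C\<close>, of ?U ?V] by blast
qed

lemma same_side_unless_between:
  fixes x b y :: "'a::{metric_space,order}" and \<sigma> :: "real \<Rightarrow> 'b::{metric_space,order}"
  assumes "uniquely_geodesic TYPE('a)"
    and steep: "geodesic_ray \<sigma>" "mono_on {0..} \<sigma>" "antimono (busemann \<sigma>)"
      "monotone_lipschitz_extension_property TYPE('a) TYPE('b)"
    and nb: "dist x b + dist b y \<noteq> dist x y"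
  shows "(b < x \<longleftrightarrow> b < y) \<and> (x < b \<longleftrightarrow> y < b)"
proof -
  have up: "b < p" if "b < z" "dist p z < dist p b" for z p
  proof (rule ccontr)
    assume "\<not> b < p"
    then obtain G :: "'a \<Rightarrow> real" where "mono G" "G z \<le> G p + dist z p"
      "G b = G p + dist p b"
      using extension_property_steep_function[OF steep] by blast
    moreover have "G b \<le> G z"
      using \<open>mono G\<close> \<open>b < z\<close> by (simp add: monoD)
    moreover have "G z \<le> G p + dist p z"
      using \<open>G z \<le> G p + dist z p\<close> by (simp add: dist_commute)
    ultimately show False
      using \<open>dist p z < dist p b\<close> by linarith
  qed
  have down: "p < b" if "z < b" "dist p z < dist p b" for z p
  proof (rule ccontr)
    assume "\<not> p < b"
    then obtain G :: "'a \<Rightarrow> real" where "mono G" "G p \<le> G z + dist p z"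
      "G p = G b + dist p b"
      using extension_property_steep_function[OF steep] by (metis dist_commute)
    moreover have "G z \<le> G b"
      using \<open>mono G\<close> \<open>z < b\<close> by (simp add: monoD)
    ultimately show False
      using \<open>dist p z < dist p b\<close> by linarith
  qed
  obtain C where C: "connected C" "x \<in> C" "y \<in> C" "b \<notin> C"
    using geodesic_connected_between[OF assms(1), of x y] nb by metis
  have "b < v" if "u \<in> C" "b < u" "v \<in> C" for u v
    by (rule connected_propagates[where P = "\<lambda>z. b < z" and b = b and C = C and x = u])
      (use up C that in blast)+
  moreover have "v < b" if "u \<in> C" "u < b" "v \<in> C" for u v
    by (rule connected_propagates[where P = "\<lambda>z. z < b" and b = b and C = C and x = u])
      (use down C that in blast)+
  ultimately show ?thesis
    using C(2,3) by blast
qed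

section \<open>From one strict inequality to an interval\<close>

text \<open>If \<open>b\<close> is not between \<open>a\<close> and \<open>c\<close>, then \<open>c\<close> lies above \<open>b\<close> because \<open>a\<close> does.  Otherwise
  neither \<open>a\<close> nor \<open>c\<close> is between the other two points, and \<open>b < a\<close> carries over to \<open>c < a\<close> and then
  to \<open>c < b\<close>.  The dual argument compares \<open>c\<close> with \<open>a\<close>, so every point is in turn an end of a strict
  inequality.\<close>

lemma total_order_of_same_side:
  fixes a b :: "'a::{metric_space,order}"
  assumes side: "\<And>x b y :: 'a. dist x b + dist b y \<noteq> dist x y \<Longrightarrow>
      (b < x \<longleftrightarrow> b < y) \<and> (x < b \<longleftrightarrow> y < b)"
    and "b < a"
  shows "x \<le> y \<or> y \<le> (x :: 'a)"
proof -
  have lower: "b < c \<or> c < b" if "b < a" "c \<noteq> b" for a b c :: 'a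
  proof (cases "dist a b + dist b c = dist a c")
    case True
    moreover have "0 < dist a b" "0 < dist b c"
      using that by auto
    ultimately have "dist b a + dist a c \<noteq> dist b c" "dist a c + dist c b \<noteq> dist a b"
      unfolding dist_commute[of b a] dist_commute[of c b] by linarith+
    with side that show ?thesis by blast
  next
    case False
    with side that show ?thesis by blast
  qed
  have upper: "a < c \<or> c < a" if "b < a" "c \<noteq> a" for a b c :: 'a
  proof (cases "dist b a + dist a c = dist b c")
    case True
    moreover have "0 < dist b a" "0 < dist a c"
      using that by auto
    ultimately have "dist a b + dist b c \<noteq> dist a c" "dist b c + dist c a \<noteq> dist b a"
      unfolding dist_commute[of a b] dist_commute[of c a] by linarith+
    with side that show ?thesis by blast
  next
    case False
    with side that show ?thesis by blast
  qed
  show ?thesis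
  proof (cases "x = b")
    case True
    then show ?thesis using lower[OF \<open>b < a\<close>, of y] by (cases "y = b") (auto intro: less_imp_le)
  next
    case False
    with lower[OF \<open>b < a\<close>] have "b < x \<or> x < b" .
    then show ?thesis
    proof
      assume "b < x"
      then show ?thesis using upper[of b x y] by (cases "y = x") (auto intro: less_imp_le)
    next
      assume "x < b"
      then show ?thesis using lower[of x b y] by (cases "y = x") (auto intro: less_imp_le)
    qed
  qed
qed

text \<open>The embedding is the distance from an arbitrary base point, signed by the order.\<close>

lemma isometric_interval_of_additive_total_order:
  assumes conn: "connected (UNIV :: 'a::{metric_space,order} set)"
    and total: "\<And>x y :: 'a. x \<le> y \<or> y \<le> x"
    and add: "\<And>x y z :: 'a. x \<le> y \<Longrightarrow> y \<le> z \<Longrightarrow> dist x y + dist y z = dist x z"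
  shows "\<exists>I :: real set. is_interval I \<and> isometric (UNIV :: 'a set) I"
proof -
  define base :: 'a where "base = undefined"
  define g where "g x = (if base \<le> x then dist base x else - dist base x)" for x
  have diff: "g y - g x = dist x y" if "x \<le> y" for x y
  proof (cases "base \<le> x")
    case True
    from order_trans[OF True that] have "base \<le> y" .
    with True that add[of base x y] show ?thesis by (simp add: g_def)
  next
    case False
    then have "x \<le> base" using total by blast
    show ?thesis
    proof (cases "base \<le> y")
      case True
      with False \<open>x \<le> base\<close> add[of x base y] show ?thesis by (simp add: g_def dist_commute)
    next
      case no: False
      then have "y \<le> base" using total by blast
      with False no that add[of x y base] show ?thesis by (simp add: g_def dist_commute)
    qed
  qed
  have iso: "dist (g x) (g y) = dist x y" for x y
    using total[of x y]
  proof
    assume "x \<le> y"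
    from diff[OF this] show ?thesis
      unfolding dist_real_def using zero_le_dist[of x y] by linarith
  next
    assume "y \<le> x"
    from diff[OF this] show ?thesis
      unfolding dist_real_def dist_commute[of x y] using zero_le_dist[of y x] by linarith
  qed
  have "inj g"
    by (rule injI) (metis iso dist_eq_0_iff)
  then have "bij_betw g UNIV (range g)"
    by (rule inj_on_imp_bij_betw)
  then have "isometric (UNIV :: 'a set) (range g)"
    unfolding isometric_def using iso by blast
  moreover have "1-lipschitz_on (UNIV :: 'a set) g"
    by (rule lipschitz_onI) (simp_all add: iso)
  then have "is_interval (range g)"
    unfolding is_interval_connected_1
    by (intro connected_continuous_image lipschitz_on_continuous_on conn)
  ultimately show ?thesis by blast
qed

theorem theorem8:
  fixes \<sigma> :: "real \<Rightarrow> 'b::{metric_space,order}"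
  assumes "uniquely_geodesic TYPE('a::{metric_space,order})"
    and "nonbranching TYPE('a)"
    and "\<not> (\<exists>I :: real set. is_interval I \<and> isometric (UNIV :: 'a set) I)"
    and "geodesic_ray \<sigma>"
    and "mono_on {0..} \<sigma>"
    and "antimono (busemann \<sigma>)"
    and "monotone_lipschitz_extension_property TYPE('a) TYPE('b)"
  shows "((\<le>) :: 'a \<Rightarrow> 'a \<Rightarrow> bool) = (=)"
proof (rule ccontr)
  assume "((\<le>) :: 'a \<Rightarrow> 'a \<Rightarrow> bool) \<noteq> (=)"
  then obtain a b :: 'a where "b < a"
    by (auto simp: fun_eq_iff less_le)
  note side = same_side_unless_between[OF assms(1,4-7)]
  have "connected_component UNIV x y" for x y :: 'a
    by (rule geodesic_connected_between[OF assms(1), of x y])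
      (auto simp: connected_component_def)
  then have "connected (UNIV :: 'a set)"
    by (simp add: connected_iff_connected_component)
  moreover have "x \<le> y \<or> y \<le> x" for x y :: 'a
    using side \<open>b < a\<close> by (rule total_order_of_same_side)
  moreover have "dist x y + dist y z = dist x z" if "x \<le> y" "y \<le> z" for x y z :: 'a
  proof (cases "x = y \<or> y = z")
    case False
    \<comment> \<open>\<open>z\<close> lies above \<open>y\<close> and \<open>x\<close> does not, so \<open>y\<close> has to be between them.\<close>
    with that have "y < z" "\<not> y < x" by auto
    then show ?thesis using side[of x y z] by blast
  qed auto
  ultimately show False
    using isometric_interval_of_additive_total_order assms(3) by blast
qed

end
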